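(* For all integers $\ell\ge 0$, $k\ge 1$ and all $\mathbf n\in\mathbb Z_+^k$, $$N^{(k)}_{\ell,\mathbf n}(q)=M^{(k)}_{\ell,\mathbf n}(q).$$
   Context: $\mathbb Z_+=\{0,1,2,\dots\}$. For $a\in\mathbb Z_+$, $b\in\mathbb Z$, the $q$-binomial coefficient $\left[\begin{matrix}a+b\\ a\end{matrix}\right]_q$ is defined by $$\sum_{a\in\mathbb Z_+}\left[\begin{matrix}a+b\\ a\end{matrix}\right]_q x^a=\begin{cases}\prod_{i=0}^{b}(1-q^ix)^{-1}& b\ge 0,\\ \prod_{i=0}^{-b-1}(1-q^{i+b+1}x)& b<0,\end{cases}$$ so it need not vanish for $b<0$. Fix $k\ge1$ and let $A$ be the $k\times k$ matrix $A_{i,j}=\min(i,j)$. For $\mathbf m=(m_1,\dots,m_k)^t$, $\mathbf n=(n_1,\dots,n_k)^t\in\mathbb Z_+^k$ and $\ell\in\mathbb Z$ put $$p_j=\sum_{i=1}^k\min(i,j)(n_i-2m_i)\ (1\le j\le k),\qquad q_0=\ell+\sum_{i=1}^k i(2m_i-n_i),\qquad Q(\mathbf m,\mathbf n)=\mathbf m^tA(\mathbf m-\mathbf n).$$ The Laurent polynomials $M^{(k)}_{\ell,\mathbf n}$, $N^{(k)}_{\ell,\mathbf n}$ are defined by $$M^{(k)}_{\ell,\mathbf n}(q^{-1})=\sum_{\substack{m_1,\dots,m_k\in\mathbb Z_+\\ q_0=0;\ p_1,\dots,p_k\ge0}}q^{Q(\mathbf m,\mathbf n)}\prod_{i=1}^k\left[\begin{matrix}m_i+p_i\\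 m_i\end{matrix}\right]_q,\qquad N^{(k)}_{\ell,\mathbf n}(q^{-1})=\sum_{\substack{m_1,\dots,m_k\in\mathbb Z_+\\ q_0=0}}q^{Q(\mathbf m,\mathbf n)}\prod_{i=1}^k\left[\begin{matrix}m_i+p_i\\ m_i\end{matrix}\right]_q .$$
   Formalization: In the q-binomial generating function for b<0 the upper limit of the product is -b-2 instead of the printed -b-1; with the printed limit the claim fails for k=2, ℓ=0, n=(0,1), where N=-1 and M=0. *)

theory Defs
  imports "HOL-Computational_Algebra.Formal_Power_Series" "HOL-Library.Poly_Mapping"
    "HOL-Library.FuncSet"
begin

text \<open>
  The ring of integer Laurent polynomials in \<open>q\<close>, as the monoid ring of \<open>(\<int>, +)\<close> over \<open>\<int>\<close>:
  the value of the finitely supported function at \<open>e\<close> is the coefficient of \<open>q\<close> to the power \<open>e\<close>.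
\<close>

type_synonym laurent = "int \<Rightarrow>\<^sub>0 int"

definition qpow :: "int \<Rightarrow> laurent" where
  "qpow e = Poly_Mapping.single e 1"

text \<open>The substitution of \<open>q\<close> inverse for \<open>q\<close>.\<close>

definition invert_q :: "laurent \<Rightarrow> laurent" where
  "invert_q f = Poly_Mapping.map_key uminus f"

lemma lookup_invert_q: "Poly_Mapping.lookup (invert_q f) e = Poly_Mapping.lookup f (- e)"
  unfolding invert_q_def by (subst Poly_Mapping.map_key.rep_eq) (auto simp: inj_def)

text \<open>
  The generating function, a power series in \<open>x\<close> over the Laurent polynomials, of the
  \<open>q\<close>-binomials \<open>[a + b, a]\<close> with \<open>b\<close> fixed.  As the coefficient ring is not a field, the
  multiplicative inverse is taken with \<^const>\<open>fps_right_inverse_constructor\<close>; see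
  \<open>qbinom_gf_nonneg\<close> below.

  For \<open>b < 0\<close> there are \<open>-b - 1\<close> factors, with exponents \<open>b + 1, \<dots>, -1\<close>.  This is the range
  for which \<open>[a + b, a]\<close> is the product of \<open>(1 - q^(b+s)) / (1 - q^s)\<close> over \<open>s = 1, \<dots>, a\<close>
  for every integer \<open>b\<close>, as in the case \<open>b \<ge> 0\<close>.  The upper bound \<open>i = -b - 1\<close> instead of
  \<open>i = -b - 2\<close> that is sometimes printed would add a spurious factor \<open>1 - x\<close>; then
  \<open>[0, 1] = -1\<close>, and the sums \<open>N_sum\<close> and \<open>M_sum\<close> below would differ, being \<open>-1\<close> and \<open>0\<close>,
  for \<open>k = 2\<close>, \<open>l = 0\<close>, \<open>n = (0, 1)\<close>.
\<close>

definition qbinom_gf :: "int \<Rightarrow> laurent fps" where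
  "qbinom_gf b =
     (if b \<ge> 0 then fps_right_inverse (\<Prod>i\<in>{0..b}. 1 - fps_const (qpow i) * fps_X) 1
      else (\<Prod>i\<in>{0..-b - 2}. 1 - fps_const (qpow (i + b + 1)) * fps_X))"

text \<open>\<open>qbinom a b\<close> is the \<open>q\<close>-binomial with top entry \<open>a + b\<close> (not \<open>b\<close>) and bottom entry \<open>a\<close>.\<close>

definition qbinom :: "nat \<Rightarrow> int \<Rightarrow> laurent" where
  "qbinom a b = fps_nth (qbinom_gf b) a"

lemma qbinom_gf_nonneg:
  assumes "b \<ge> 0"
  shows "(\<Prod>i\<in>{0..b}. 1 - fps_const (qpow i) * fps_X) * qbinom_gf b = 1"
proof -
  have "fps_nth (\<Prod>i\<in>A. 1 - fps_const (qpow i) * fps_X) 0 = 1" if "finite A" for A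
    using that by (induction A) (auto simp: fps_mult_nth_0)
  then show ?thesis
    unfolding qbinom_gf_def using assms by (simp add: fps_right_inverse)
qed

text \<open>
  Vectors \<open>(v_1, \<dots>, v_k)\<close> are functions on \<open>nat\<close> of which only the values at \<open>1, \<dots>, k\<close> are used.
\<close>

definition A_entry :: "nat \<Rightarrow> nat \<Rightarrow> int" where
  "A_entry i j = int (min i j)"

definition p_vec :: "nat \<Rightarrow> (nat \<Rightarrow> nat) \<Rightarrow> (nat \<Rightarrow> nat) \<Rightarrow> nat \<Rightarrow> int" where
  "p_vec k m n j = (\<Sum>i\<in>{1..k}. A_entry i j * (int (n i) - 2 * int (m i)))"

definition q_zero :: "nat \<Rightarrow> int \<Rightarrow> (nat \<Rightarrow> nat) \<Rightarrow> (nat \<Rightarrow> nat) \<Rightarrow> int" where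
  "q_zero k l m n = l + (\<Sum>i\<in>{1..k}. int i * (2 * int (m i) - int (n i)))"

definition Q_form :: "nat \<Rightarrow> (nat \<Rightarrow> nat) \<Rightarrow> (nat \<Rightarrow> nat) \<Rightarrow> int" where
  "Q_form k m n =
     (\<Sum>i\<in>{1..k}. \<Sum>j\<in>{1..k}. int (m i) * A_entry i j * (int (m j) - int (n j)))"

text \<open>
  The index sets of the two sums.  The extensional function space makes \<open>m\<close> range over vectors
  indexed by \<open>{1..k}\<close>, each counted once.
\<close>

definition N_index :: "nat \<Rightarrow> int \<Rightarrow> (nat \<Rightarrow> nat) \<Rightarrow> (nat \<Rightarrow> nat) set" where
  "N_index k l n = {m \<in> {1..k} \<rightarrow>\<^sub>E UNIV. q_zero k l m n = 0}"

definition M_index :: "nat \<Rightarrow> int \<Rightarrow> (nat \<Rightarrow> nat) \<Rightarrow> (nat \<Rightarrow> nat) set" where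
  "M_index k l n = {m \<in> {1..k} \<rightarrow>\<^sub>E UNIV. q_zero k l m n = 0 \<and> (\<forall>j\<in>{1..k}. p_vec k m n j \<ge> 0)}"

lemma finite_N_index: "finite (N_index k l n)"
proof (rule finite_subset)
  let ?B = "nat ((\<Sum>i\<in>{1..k}. int i * int (n i)) - l)"
  show "N_index k l n \<subseteq> {1..k} \<rightarrow>\<^sub>E {..?B}"
  proof
    fix m assume m: "m \<in> N_index k l n"
    then have ext: "m \<in> {1..k} \<rightarrow>\<^sub>E UNIV" and q: "q_zero k l m n = 0"
      by (auto simp: N_index_def)
    have s: "2 * (\<Sum>i\<in>{1..k}. int i * int (m i)) = (\<Sum>i\<in>{1..k}. int i * int (n i)) - l"
      using q unfolding q_zero_def
      by (simp add: right_diff_distrib sum_subtractf sum_distrib_left mult.left_commute)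
    have "m j \<le> ?B" if j: "j \<in> {1..k}" for j
    proof -
      have "int (m j) \<le> int j * int (m j)"
        using j by (cases "m j") (auto simp: mult_le_cancel_right1)
      also have "\<dots> \<le> (\<Sum>i\<in>{1..k}. int i * int (m i))"
        by (rule member_le_sum[OF j]) auto
      also have "\<dots> \<le> 2 * (\<Sum>i\<in>{1..k}. int i * int (m i))"
        using sum_nonneg[of "{1..k}" "\<lambda>i. int i * int (m i)"] by simp
      finally show ?thesis unfolding s by linarith
    qed
    then show "m \<in> {1..k} \<rightarrow>\<^sub>E {..?B}"
      using ext by (auto simp: PiE_iff)
  qed
  show "finite ({1..k} \<rightarrow>\<^sub>E {..?B})"
    by (intro finite_PiE) auto
qed

lemma finite_M_index: "finite (M_index k l n)"
  by (rule finite_subset[OF _ finite_N_index]) (auto simp: M_index_def N_index_def)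

definition fermionic_term :: "nat \<Rightarrow> (nat \<Rightarrow> nat) \<Rightarrow> (nat \<Rightarrow> nat) \<Rightarrow> laurent" where
  "fermionic_term k m n =
     qpow (Q_form k m n) * (\<Prod>i\<in>{1..k}. qbinom (m i) (p_vec k m n i))"

text \<open>The values at \<open>q\<close> inverse, and then the Laurent polynomials themselves.\<close>

definition M_sum :: "nat \<Rightarrow> int \<Rightarrow> (nat \<Rightarrow> nat) \<Rightarrow> laurent" where
  "M_sum k l n = (\<Sum>m\<in>M_index k l n. fermionic_term k m n)"

definition N_sum :: "nat \<Rightarrow> int \<Rightarrow> (nat \<Rightarrow> nat) \<Rightarrow> laurent" where
  "N_sum k l n = (\<Sum>m\<in>N_index k l n. fermionic_term k m n)"

definition M_poly :: "nat \<Rightarrow> int \<Rightarrow> (nat \<Rightarrow> nat) \<Rightarrow> laurent" where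
  "M_poly k l n = invert_q (M_sum k l n)"

definition N_poly :: "nat \<Rightarrow> int \<Rightarrow> (nat \<Rightarrow> nat) \<Rightarrow> laurent" where
  "N_poly k l n = invert_q (N_sum k l n)"

end

theory Submission
  imports Defs "HOL-Library.Groups_Big_Fun"
begin

text \<open>
  Put \<open>q_i = q_0 + p_i\<close>, so that \<open>q_(i-1) = 2 q_i - q_(i+1) + 2 m_i - n_i\<close>.  Up to a power of \<open>v = q^(1/2)\<close>, the
  sum over \<open>m_1, \<dots>, m_j\<close> for given \<open>q_j\<close> and \<open>q_(j+1)\<close> is the value of a fixed functional at the
  monomial \<open>Q_1^n_1 \<dots> Q_j^n_j Q_j^(q_(j+1) + 1) Q_(j+1)^(- q_j - 1)\<close> in the solution of the quantum
  Q-system of type \<open>A_1\<close>: expanding the powers of \<open>Q_(j+1) = v\<inverse> Q_(j-1)\<inverse> (Q_j\<^sup>2 - 1)\<close> by the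
  \<open>q\<close>-binomial theorem produces the sum over \<open>m_j\<close>.  The functional evaluates at \<open>Q_0 = 1\<close> and
  extracts the coefficient of \<open>Q_1\<close> to the \<open>-1\<close>.  By the Laurent phenomenon, in the form of the linear
  recursion \<open>H Q_j = v Q_(j+1) + Q_(j-1)\<close> with the conserved quantity \<open>H\<close>, monomials with
  nonnegative exponents become polynomials in \<open>Q_1\<close>, on which the functional vanishes.  Hence the
  terms with \<open>q_j < 0 \<le> q_(j+1)\<close> cancel, and going down from \<open>q_k = \<ell> \<ge> 0\<close> the restrictions
  \<open>q_j \<ge> 0\<close> can be imposed one after the other.
\<close>

subsection \<open>Laurent polynomials in a square root of q\<close>

lemma qpow_0 [simp]: "qpow 0 = 1"
  by (simp add: qpow_def)

lemma qpow_add: "qpow (a + b) = qpow a * qpow b"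
  by (simp add: qpow_def mult_single)

lemma qpow_neq_0 [simp]: "qpow a \<noteq> 0"
  by (simp add: qpow_def)

text \<open>Substitution of q^2 for q. Its image leaves the odd powers free, so that
  \<open>qpow 1\<close> can serve as v = q^(1/2).\<close>

definition double_q :: "laurent \<Rightarrow> laurent" where
  "double_q = frag_extend (\<lambda>e. qpow (2 * e))"

lemma qpow_frag_of: "qpow e = frag_of e"
  by (simp add: qpow_def)

lemma double_q_qpow [simp]: "double_q (qpow e) = qpow (2 * e)"
  by (simp add: double_q_def qpow_frag_of)

lemma double_q_0 [simp]: "double_q 0 = 0"
  by (simp add: double_q_def)

lemma double_q_1 [simp]: "double_q 1 = 1"
  using double_q_qpow[of 0] by simp

lemma double_q_diff: "double_q (x - y) = double_q x - double_q y"
  by (simp add: double_q_def frag_extend_diff)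

lemma double_q_add: "double_q (x + y) = double_q x + double_q y"
  by (simp add: double_q_def frag_extend_add)

lemma laurent_induct [case_names zero qpow diff]:
  assumes "P 0" "\<And>e. P (qpow e)" "\<And>x y. P x \<Longrightarrow> P y \<Longrightarrow> P (x - y)"
  shows "P x"
  by (rule frag_induction[of x UNIV]) (use assms in \<open>auto simp: qpow_frag_of\<close>)

lemma double_q_mult: "double_q (x * y) = double_q x * double_q y"
proof (induction x rule: laurent_induct)
  case (qpow a)
  show ?case
  proof (induction y rule: laurent_induct)
    case (qpow b)
    show ?case by (simp add: distrib_left flip: qpow_add)
  qed (auto simp: right_diff_distrib double_q_diff)
qed (auto simp: left_diff_distrib double_q_diff)

lemma double_q_sum: "double_q (sum f A) = (\<Sum>x\<in>A. double_q (f x))"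
  by (induction A rule: infinite_finite_induct) (auto simp: double_q_add)

lemma double_q_prod: "double_q (prod f A) = (\<Prod>x\<in>A. double_q (f x))"
  by (induction A rule: infinite_finite_induct) (auto simp: double_q_mult)

lemma inj_double_q: "inj double_q"
proof (rule inj_on_inverseI)
  have inj: "inj ((*) (2::int))"
    by (auto simp: inj_def)
  show "Poly_Mapping.map_key ((*) 2) (double_q x) = x" for x
  proof (induction x rule: laurent_induct)
    case zero
    show ?case by (simp add: map_key_zero[OF inj])
  next
    case (qpow e)
    show ?case using map_key_single[OF inj, of e 1] by (simp add: qpow_def double_q_def)
  next
    case (diff x y)
    have "Poly_Mapping.map_key ((*) 2) (u - w) =
        Poly_Mapping.map_key ((*) 2) u - Poly_Mapping.map_key ((*) 2) w" for u w :: laurent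
      by (rule poly_mapping_eqI) (simp add: map_key.rep_eq[OF inj] lookup_minus)
    then show ?case using diff by (simp add: double_q_diff)
  qed
qed

subsection \<open>The q-binomial theorem\<close>

definition qfactors :: "int set \<Rightarrow> laurent fps" where
  "qfactors I = (\<Prod>i\<in>I. 1 - fps_const (qpow i) * fps_X)"

text \<open>Substitution of q x for x.\<close>

definition scale_X :: "laurent fps \<Rightarrow> laurent fps" where
  "scale_X f = Abs_fps (\<lambda>m. qpow (int m) * fps_nth f m)"

lemma scale_X_mult: "scale_X (f * g) = scale_X f * scale_X g"
proof (rule fps_ext)
  fix m
  have "qpow (int m) * (fps_nth f i * fps_nth g (m - i)) =
      (qpow (int i) * fps_nth f i) * (qpow (int (m - i)) * fps_nth g (m - i))"
    if "i \<in> {0..m}" for i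
    using that qpow_add[of "int i" "int (m - i)"] by (simp add: mult_ac of_nat_diff)
  then show "fps_nth (scale_X (f * g)) m = fps_nth (scale_X f * scale_X g) m"
    by (auto simp: scale_X_def fps_mult_nth sum_distrib_left intro!: sum.cong)
qed

lemma scale_X_1 [simp]: "scale_X 1 = 1"
  by (rule fps_ext) (auto simp: scale_X_def)

lemma scale_X_linear:
  "scale_X (1 - fps_const (qpow i) * fps_X) = 1 - fps_const (qpow (i + 1)) * fps_X"
  by (rule fps_ext) (auto simp: scale_X_def qpow_add mult.commute fps_X_nth)

lemma scale_X_qfactors: "scale_X (qfactors {a..b}) = qfactors {a + 1..b + 1}"
proof -
  have "scale_X (qfactors I) = (\<Prod>i\<in>I. 1 - fps_const (qpow (i + 1)) * fps_X)"
    if "finite I" for I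
    using that by induction (auto simp: qfactors_def scale_X_mult scale_X_linear)
  moreover have "(\<Prod>i\<in>{a..b}. 1 - fps_const (qpow (i + 1)) * fps_X) = qfactors {a + 1..b + 1}"
    unfolding qfactors_def
    by (rule prod.reindex_bij_witness[of _ "\<lambda>i. i - 1" "\<lambda>i. i + 1"]) auto
  ultimately show ?thesis by simp
qed

lemma qbinom_gf_neg:
  assumes "b < 0"
  shows "qbinom_gf b = qfactors {b + 1..-1}"
proof -
  have "(\<Prod>i\<in>{0..-b - 2}. 1 - fps_const (qpow (i + b + 1)) * fps_X) = qfactors {b + 1..-1}"
    unfolding qfactors_def
    by (rule prod.reindex_bij_witness[of _ "\<lambda>i. i - b - 1" "\<lambda>i. i + b + 1"]) auto
  then show ?thesis using assms by (simp add: qbinom_gf_def)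
qed

lemma qfactors_first:
  assumes "a \<le> b"
  shows "qfactors {a..b} = (1 - fps_const (qpow a) * fps_X) * qfactors {a + 1..b}"
proof -
  have "{a..b} = insert a {a + 1..b}" using assms by auto
  then show ?thesis by (simp add: qfactors_def)
qed

lemma qfactors_last:
  assumes "a \<le> b"
  shows "qfactors {a..b} = qfactors {a..b - 1} * (1 - fps_const (qpow b) * fps_X)"
proof -
  have "{a..b} = insert b {a..b - 1}" using assms by auto
  then show ?thesis by (simp add: qfactors_def mult.commute)
qed

text \<open>Formally \<open>qbinom_gf b\<close> is 1/(x; q)_(b+1) for every integer b, and 1/(q x;
  q)_b = (1 - x)/(x; q)_(b+1).\<close>

lemma qbinom_gf_pred: "scale_X (qbinom_gf (b - 1)) = (1 - fps_X) * qbinom_gf b"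
proof -
  consider "b \<ge> 1" | "b = 0" | "b < 0" by linarith
  then show ?thesis
  proof cases
    case 1
    let ?P = "qfactors {1..b}"
    have "qfactors {0..b - 1} * qbinom_gf (b - 1) = 1"
      using 1 qbinom_gf_nonneg[of "b - 1"] by (simp add: qfactors_def)
    then have "scale_X (qfactors {0..b - 1}) * scale_X (qbinom_gf (b - 1)) = 1"
      by (metis scale_X_mult scale_X_1)
    then have "?P * scale_X (qbinom_gf (b - 1)) = 1"
      by (simp add: scale_X_qfactors)
    moreover have "?P * ((1 - fps_X) * qbinom_gf b) = 1"
    proof -
      have "qfactors {0..b} = ?P * (1 - fps_X)"
        using 1 qfactors_first[of 0 b] by (simp add: mult.commute)
      moreover have "qfactors {0..b} * qbinom_gf b = 1"
        using 1 qbinom_gf_nonneg[of b] by (simp add: qfactors_def)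
      ultimately show ?thesis
        by (metis mult.assoc)
    qed
    \<comment> \<open>Two inverses of \<open>?P\<close> coincide.\<close>
    ultimately have "scale_X (qbinom_gf (b - 1)) * ?P * ((1 - fps_X) * qbinom_gf b) =
        (1 - fps_X) * qbinom_gf b" "scale_X (qbinom_gf (b - 1)) * (?P * ((1 - fps_X) * qbinom_gf b)) =
        scale_X (qbinom_gf (b - 1))"
      by (simp_all add: mult.commute[of _ ?P])
    then show ?thesis
      by (metis mult.assoc)
  next
    case 2
    have "(1 - fps_X) * qbinom_gf 0 = 1"
      using qbinom_gf_nonneg[of 0] by simp
    then show ?thesis using 2 qbinom_gf_neg[of "-1"] by (simp add: qfactors_def)
  next
    case 3
    then show ?thesis
      using scale_X_qfactors[of b "-1"] qfactors_last[of "b + 1" 0]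
      by (simp add: qbinom_gf_neg mult.commute)
  qed
qed

lemma qbinom_Suc:
  "qpow (int m + 1) * qbinom (Suc m) (b - 1) = qbinom (Suc m) b - qbinom m b"
  using arg_cong[OF qbinom_gf_pred[of b], of "\<lambda>f. fps_nth f (Suc m)"]
  by (simp add: scale_X_def qbinom_def left_diff_distrib add.commute)

lemma qbinom_0 [simp]: "qbinom 0 b = 1"
proof -
  have "fps_nth (qfactors I) 0 = 1" if "finite I" for I
    using that by induction (auto simp: qfactors_def)
  moreover have "fps_nth (qfactors {0..b}) 0 * fps_nth (qbinom_gf b) 0 = 1" if "b \<ge> 0"
    using qbinom_gf_nonneg[OF that] by (metis fps_mult_nth_0 fps_one_nth qfactors_def)
  ultimately show ?thesis
    by (cases "b \<ge> 0") (auto simp: qbinom_def qbinom_gf_neg)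
qed

lemma qbinom_minus_1: "qbinom m (-1) = (if m = 0 then 1 else 0)"
  by (simp add: qbinom_def qbinom_gf_neg qfactors_def)

text \<open>
  The coefficient of \<open>x^m\<close> in the \<open>q\<close>-shifted factorial \<open>(x; q)_g\<close>, for every integer \<open>g\<close>, with
  \<open>q\<close> replaced by its square so that half-integral powers of \<open>q\<close> are available.
\<close>

definition poch :: "nat \<Rightarrow> int \<Rightarrow> laurent" where
  "poch m g = qpow (2 * g * int m) * double_q (qbinom m (- g - 1))"

lemma poch_0_left [simp]: "poch 0 g = 1"
  by (simp add: poch_def)

lemma poch_0_right: "poch m 0 = (if m = 0 then 1 else 0)"
  by (simp add: poch_def qbinom_minus_1)

text \<open>Coefficient form of (x; q)_(g+1) = (x; q)_g (1 - q^g x), also for negative g.\<close>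

lemma poch_Suc: "poch (Suc m) (g + 1) = poch (Suc m) g - qpow (2 * g) * poch m g"
proof -
  let ?B = "\<lambda>m b. double_q (qbinom m b)"
  have "qpow (2 * int m + 2) * ?B (Suc m) (- g - 2) = ?B (Suc m) (- g - 1) - ?B m (- g - 1)"
    using arg_cong[OF qbinom_Suc[of m "- g - 1"], of double_q]
    by (simp add: double_q_mult double_q_diff algebra_simps)
  then have "qpow (2 * g * int (Suc m)) * (qpow (2 * int m + 2) * ?B (Suc m) (- g - 2)) =
      qpow (2 * g * int (Suc m)) * (?B (Suc m) (- g - 1) - ?B m (- g - 1))"
    by simp
  then show ?thesis
    unfolding poch_def right_diff_distrib mult.assoc[symmetric] qpow_add[symmetric]
    by (simp add: algebra_simps)
qed

text \<open>The image of (x; q)_g under the linear map sending x^m to \<open>h m\<close>. For g < 0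
  the series is infinite, which is why \<open>Sum_any\<close> is used.\<close>

definition poch_sum :: "int \<Rightarrow> (nat \<Rightarrow> laurent) \<Rightarrow> laurent" where
  "poch_sum g h = Sum_any (\<lambda>m. poch m g * h m)"

lemma poch_sum_eq_sum:
  assumes "\<And>m. m > K \<Longrightarrow> h m = 0"
  shows "poch_sum g h = (\<Sum>m\<le>K. poch m g * h m)"
  unfolding poch_sum_def using assms
  by (intro Sum_any.expand_superset) (auto simp: not_less[symmetric])

lemma poch_sum_0 [simp]: "poch_sum 0 h = h 0"
proof -
  have "poch_sum 0 h = (\<Sum>m\<in>{0}. poch m 0 * h m)"
    unfolding poch_sum_def by (intro Sum_any.expand_superset) (auto simp: poch_0_right)
  then show ?thesis by simp
qed

lemma poch_sum_Suc:
  assumes "\<And>m. m > K \<Longrightarrow> h m = 0"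
  shows "poch_sum (g + 1) h = poch_sum g h - qpow (2 * g) * poch_sum g (\<lambda>m. h (Suc m))"
proof -
  have e: "poch_sum g h = (\<Sum>m\<le>Suc K. poch m g * h m)" for g
    by (rule poch_sum_eq_sum) (use assms in auto)
  have "poch_sum g (\<lambda>m. h (Suc m)) = (\<Sum>m\<le>K. poch m g * h (Suc m))"
    by (rule poch_sum_eq_sum) (use assms in auto)
  then show ?thesis
    unfolding e sum.atMost_Suc_shift
    by (simp add: poch_Suc left_diff_distrib right_diff_distrib sum_subtractf sum_distrib_left mult_ac)
qed

lemma poch_sum_linear:
  assumes "\<And>m. m > K \<Longrightarrow> h1 m = 0" "\<And>m. m > K \<Longrightarrow> h2 m = 0" "\<And>m. m > K \<Longrightarrow> h3 m = 0"
  shows "poch_sum g (\<lambda>m. a * h1 m + b * h2 m - c * h3 m) =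
    a * poch_sum g h1 + b * poch_sum g h2 - c * poch_sum g h3"
  using assms
  by (simp add: poch_sum_eq_sum[of K] sum_distrib_left sum.distrib sum_subtractf algebra_simps)

subsection \<open>The quantum Q-system\<close>

text \<open>
  Let \<open>Q_i\<close> solve the quantum Q-system \<open>Q_i Q_(i+1) = v\<inverse> Q_(i+1) Q_i\<close>,
  \<open>v Q_(i-1) Q_(i+1) = Q_i\<^sup>2 - 1\<close> with \<open>v\<^sup>2 = q\<close>, where
  \<^term>\<open>qpow e\<close> now stands for \<open>v^e\<close>.  A function \<open>f\<close> stands for a linear functional of
  the ordered monomials \<open>f b g = f (Q_i^b Q_(i+1)^g)\<close>.  Then \<open>shift\<close> and \<open>ham\<close> precompose with
  left multiplication by \<open>Q_i\<close> and by the conserved quantity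
  \<open>Q_i\<inverse> Q_(i+1) + Q_i Q_(i+1)\<inverse> - Q_i\<inverse> Q_(i+1)\<inverse>\<close>, which does not depend on \<open>i\<close>, and \<open>transfer\<close>
  rewrites a functional of \<open>Q_(i-1), Q_i\<close> in terms of \<open>Q_i, Q_(i+1)\<close>.
\<close>

type_synonym functional = "int \<Rightarrow> int \<Rightarrow> laurent"

definition shift :: "functional \<Rightarrow> functional" where
  "shift f = (\<lambda>b g. f (b + 1) g)"

definition ham :: "functional \<Rightarrow> functional" where
  "ham f = (\<lambda>b g. qpow b * f (b - 1) (g + 1) + qpow (- b) * f (b + 1) (g - 1)
    - qpow (- b) * f (b - 1) (g - 1))"

definition transfer :: "functional \<Rightarrow> functional" where
  "transfer f = (\<lambda>b g. qpow (- (g * (g + b))) * poch_sum g (\<lambda>m. f (- g) (b + 2 * g - 2 * int m)))"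

text \<open>Give Q_i degree i, so that Q_j^b Q_(j+1)^g has degree j b + (j + 1) g. Vanishing in low
  degrees makes the sums in \<open>transfer\<close> finite.\<close>

definition supported :: "nat \<Rightarrow> functional \<Rightarrow> bool" where
  "supported j f \<longleftrightarrow> (\<exists>U. \<forall>b g. int (Suc j) * g + int j * b < U \<longrightarrow> f b g = 0)"

lemma supportedE:
  assumes "supported j f"
  obtains U where "\<And>b g. int (Suc j) * g + int j * b < U \<Longrightarrow> f b g = 0"
  using assms unfolding supported_def by auto

lemma supportedI:
  assumes "\<And>b g. int (Suc j) * g + int j * b < U \<Longrightarrow> f b g = 0"
  shows "supported j f"
  using assms unfolding supported_def by blast

lemma supported_shift:
  assumes "supported j f"
  shows "supported j (shift f)"
proof -
  from assms obtain U where U: "\<And>b g. int (Suc j) * g + int j * b < U \<Longrightarrow> f b g = 0"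
    by (rule supportedE) blast
  show ?thesis
    by (rule supportedI[of _ "U - int j"]) (auto simp: shift_def algebra_simps intro!: U)
qed

text \<open>The term m = 0 of \<open>transfer\<close> preserves the degree, and each increment of m
  lowers it by 2 (j + 1).\<close>

lemma supported_transfer:
  assumes "supported j f"
  shows "supported (Suc j) (transfer f)"
proof -
  from assms obtain U where U: "\<And>b g. int (Suc j) * g + int j * b < U \<Longrightarrow> f b g = 0"
    by (rule supportedE) blast
  have "transfer f b g = 0" if "int (Suc (Suc j)) * g + int (Suc j) * b < U" for b g
  proof -
    have "f (- g) (b + 2 * g - 2 * int m) = 0" for m
    proof (rule U)
      have "int (Suc j) * (b + 2 * g - 2 * int m) + int j * (- g) =
          int (Suc (Suc j)) * g + int (Suc j) * b - 2 * int (Suc j) * int m"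
        by (simp add: algebra_simps)
      also have "\<dots> \<le> int (Suc (Suc j)) * g + int (Suc j) * b" by simp
      finally show "int (Suc j) * (b + 2 * g - 2 * int m) + int j * (- g) < U"
        using that by simp
    qed
    then show ?thesis by (simp add: transfer_def poch_sum_def)
  qed
  then show ?thesis by (rule supportedI)
qed

lemma supported_eventually_0:
  assumes "supported j f"
  obtains K where "\<And>m. m > K \<Longrightarrow> f b (x - 2 * int m) = 0"
proof -
  from assms obtain U where U: "\<And>b g. int (Suc j) * g + int j * b < U \<Longrightarrow> f b g = 0"
    by (rule supportedE) blast
  show thesis
  proof (rule that[of "nat (int (Suc j) * x + int j * b - U)"], rule U)
    fix m assume m: "m > nat (int (Suc j) * x + int j * b - U)"
    have "int m \<le> int (Suc j) * (2 * int m)"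
      by (simp add: algebra_simps)
    then show "int (Suc j) * (x - 2 * int m) + int j * b < U"
      using m by (simp only: right_diff_distrib)
  qed
qed

text \<open>Conservation of H along the Q-system. The recursion \<open>poch_sum_Suc\<close> brings
  both sides to the same four sums.\<close>

lemma transfer_ham:
  assumes "supported j f"
  shows "transfer (ham f) = ham (transfer f)"
proof (intro ext)
  fix b g :: int
  define x where "x = b + 2 * g"
  define h1 where "h1 = (\<lambda>m. f (- g - 1) (x + 1 - 2 * int m))"
  define h2 where "h2 = (\<lambda>m. f (- g + 1) (x - 1 - 2 * int m))"
  obtain K1 where K1: "\<And>m. m > K1 \<Longrightarrow> h1 m = 0"
    unfolding h1_def using supported_eventually_0[OF assms] by blast
  obtain K2 where K2: "\<And>m. m > K2 \<Longrightarrow> h2 m = 0"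
    unfolding h2_def using supported_eventually_0[OF assms] by blast
  have "(\<lambda>m. ham f (- g) (b + 2 * g - 2 * int m)) =
      (\<lambda>m. qpow (- g) * h1 m + qpow g * h2 m - qpow g * h1 (Suc m))"
    by (intro ext) (simp add: ham_def h1_def h2_def x_def algebra_simps)
  then have L: "transfer (ham f) b g = qpow (- (g * (g + b))) * (qpow (- g) * poch_sum g h1
      + qpow g * poch_sum g h2 - qpow g * poch_sum g (\<lambda>m. h1 (Suc m)))"
    unfolding transfer_def
    by (subst poch_sum_linear[of "max K1 K2", symmetric]) (auto simp: K1 K2)
  have t1: "transfer f (b - 1) (g + 1) = qpow (- ((g + 1) * (g + b))) * poch_sum (g + 1) h1"
    unfolding transfer_def h1_def x_def minus_add_distrib[of g 1] add_uminus_conv_diff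
    by (simp add: algebra_simps)
  have t2: "transfer f (b + 1) (g - 1) = qpow (- ((g - 1) * (g + b))) * poch_sum (g - 1) h2"
    by (simp add: transfer_def h2_def x_def algebra_simps)
  have t3: "transfer f (b - 1) (g - 1) =
      qpow (- ((g - 1) * (g + b - 2))) * poch_sum (g - 1) (\<lambda>m. h2 (Suc m))"
    by (simp add: transfer_def h2_def x_def algebra_simps)
  have s1: "poch_sum (g + 1) h1 =
      poch_sum g h1 - qpow (2 * g) * poch_sum g (\<lambda>m. h1 (Suc m))"
    using poch_sum_Suc[of K1 h1 g] K1 by auto
  have s2: "poch_sum g h2 =
      poch_sum (g - 1) h2 - qpow (2 * g - 2) * poch_sum (g - 1) (\<lambda>m. h2 (Suc m))"
    using poch_sum_Suc[of K2 h2 "g - 1"] K2 by (auto simp: algebra_simps)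
  show "transfer (ham f) b g = ham (transfer f) b g"
    unfolding L
    unfolding ham_def t1 t2 t3 s1 s2 right_diff_distrib distrib_left mult.assoc[symmetric]
      qpow_add[symmetric]
    by (simp add: algebra_simps)
qed

text \<open>The relation \<open>v Q_(i-1) Q_(i+1) = Q_i\<^sup>2 - 1\<close>.\<close>

lemma transfer_shift:
  assumes "supported j f"
  shows "transfer (shift f) b g =
    qpow (- (b + 1)) * (transfer f (b + 2) (g - 1) - transfer f b (g - 1))"
proof -
  define h where "h = (\<lambda>m. f (1 - g) (b + 2 * g - 2 * int m))"
  obtain K where K: "\<And>m. m > K \<Longrightarrow> h m = 0"
    unfolding h_def using supported_eventually_0[OF assms] by blast
  have t0: "transfer (shift f) b g = qpow (- (g * (g + b))) * poch_sum g h"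
    by (simp add: transfer_def h_def shift_def algebra_simps)
  have t1: "transfer f (b + 2) (g - 1) = qpow (- ((g - 1) * (g + b + 1))) * poch_sum (g - 1) h"
    by (simp add: transfer_def h_def algebra_simps)
  have t2: "transfer f b (g - 1) =
      qpow (- ((g - 1) * (g + b - 1))) * poch_sum (g - 1) (\<lambda>m. h (Suc m))"
    by (simp add: transfer_def h_def algebra_simps)
  have s: "poch_sum g h =
      poch_sum (g - 1) h - qpow (2 * g - 2) * poch_sum (g - 1) (\<lambda>m. h (Suc m))"
    using poch_sum_Suc[of K h "g - 1"] K by (auto simp: algebra_simps)
  show ?thesis
    unfolding t0 t1 t2 s right_diff_distrib distrib_left mult.assoc[symmetric]
      qpow_add[symmetric]
    by (simp add: algebra_simps)
qed

lemma funpow_shift: "(shift ^^ n) f b g = f (b + int n) g"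
  by (induction n arbitrary: b) (auto simp: shift_def ac_simps)

text \<open>With N = n + 1 this is Q_i^N H = v^(-N) H Q_i^N + (v^N - v^(-N)) Q_(i-1) Q_i^n.\<close>

lemma ham_shift_transfer:
  assumes "supported j f"
  shows "ham ((shift ^^ Suc n) (transfer f)) b g =
    qpow (- int (Suc n)) * (shift ^^ Suc n) (transfer (ham f)) b g +
    (qpow (int (Suc n)) - qpow (- int (Suc n))) * (shift ^^ n) (transfer (shift f)) b g"
proof -
  have e: "b + 1 + int (Suc n) = b + int n + 2" "b - 1 + int (Suc n) = b + int n"
    "b + int (Suc n) + 1 = b + int n + 2" "b + int (Suc n) - 1 = b + int n"
    by auto
  show ?thesis
    unfolding funpow_shift transfer_ham[OF assms] transfer_shift[OF assms]
    unfolding ham_def e right_diff_distrib left_diff_distrib distrib_left mult.assoc[symmetric] qpow_add[symmetric]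
    by (simp add: algebra_simps)
qed

subsection \<open>Vanishing on nonnegative exponents\<close>

text \<open>The invariant of an induction on the level. Vanishing of \<open>transfer f\<close> uses
  the vanishing of functionals obtained from \<open>f\<close> by \<open>shift\<close> and
  \<open>ham\<close>, hence a class closed under both.\<close>

definition admissible :: "nat \<Rightarrow> functional set \<Rightarrow> bool" where
  "admissible j S \<longleftrightarrow> (\<forall>f\<in>S. shift f \<in> S \<and> ham f \<in> S \<and> supported j f \<and>
    (\<forall>b g. b \<ge> 0 \<longrightarrow> g \<ge> 0 \<longrightarrow> f b g = 0))"

text \<open>Linear combinations are included because of the two terms in
  \<open>ham_shift_transfer\<close>.\<close>

inductive_set transfer_span :: "functional set \<Rightarrow> functional set" for S where
  gen: "f \<in> S \<Longrightarrow> (shift ^^ n) (transfer f) \<in> transfer_span S"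
| add: "f \<in> transfer_span S \<Longrightarrow> f' \<in> transfer_span S \<Longrightarrow>
    (\<lambda>b g. a * f b g + a' * f' b g) \<in> transfer_span S"

text \<open>Multiplying H Q_i = v Q_(i+1) + Q_(i-1) by Q_i^b Q_(i+1)^g on the right expresses Q_i^b
  Q_(i+1)^(g+1) through monomials with a smaller power of Q_(i+1).\<close>

lemma transfer_vanishes:
  assumes "admissible j S" "f \<in> S" "b \<ge> 0"
  shows "transfer f b (int g) = 0"
  using assms(2,3)
proof (induction g arbitrary: f b)
  case 0
  \<comment> \<open>\<open>transfer f b 0\<close> is \<open>f 0 b\<close>.\<close>
  then show ?case using assms(1) by (simp add: transfer_def admissible_def)
next
  case (Suc g)
  have supp: "supported j f" and S: "ham f \<in> S" "shift f \<in> S"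
    using assms(1) Suc.prems by (auto simp: admissible_def)
  have "transfer (ham f) (b + 1) (int g) - transfer (shift f) b (int g) =
      qpow (b + 1) * transfer f b (int (Suc g))"
    unfolding transfer_ham[OF supp] transfer_shift[OF supp]
    by (simp add: ham_def algebra_simps)
  moreover have "transfer (ham f) (b + 1) (int g) = 0" "transfer (shift f) b (int g) = 0"
    using Suc.IH[OF S(1), of "b + 1"] Suc.IH[OF S(2), of b] Suc.prems by auto
  ultimately show ?case by simp
qed

lemma admissible_transfer_span:
  assumes S: "admissible j S"
  shows "admissible (Suc j) (transfer_span S)"
proof -
  have "shift f \<in> transfer_span S \<and> ham f \<in> transfer_span S \<and> supported (Suc j) f \<and>
      (\<forall>b g. b \<ge> 0 \<longrightarrow> g \<ge> 0 \<longrightarrow> f b g = 0)" if "f \<in> transfer_span S" for f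
    using that
  proof induction
    case (gen f n)
    have supp: "supported j f" and fS: "ham f \<in> S" "shift f \<in> S"
      using S gen by (auto simp: admissible_def)
    have "ham ((shift ^^ n) (transfer f)) \<in> transfer_span S"
    proof (cases n)
      case 0
      then show ?thesis
        using transfer_span.gen[OF fS(1), of 0] transfer_ham[OF supp] by simp
    next
      case (Suc n')
      show ?thesis
        unfolding Suc ham_shift_transfer[OF supp, abs_def]
        by (intro transfer_span.intros fS)
    qed
    moreover have "shift ((shift ^^ n) (transfer f)) \<in> transfer_span S"
      using transfer_span.gen[OF gen, of "Suc n"] by simp
    moreover have "supported (Suc j) ((shift ^^ n) (transfer f))"
      by (induction n) (auto simp: supp supported_transfer intro: supported_shift)
    moreover have "(shift ^^ n) (transfer f) b g = 0" if "b \<ge> 0" "g \<ge> 0" for b g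
      using transfer_vanishes[OF S gen, of "b + int n" "nat g"] that by (simp add: funpow_shift)
    ultimately show ?case by blast
  next
    case (add f f' a a')
    let ?f = "\<lambda>b g. a * f b g + a' * f' b g"
    have "shift ?f = (\<lambda>b g. a * shift f b g + a' * shift f' b g)"
      by (simp add: shift_def)
    moreover have "ham ?f = (\<lambda>b g. a * ham f b g + a' * ham f' b g)"
      by (intro ext) (simp add: ham_def algebra_simps)
    moreover have "supported (Suc j) ?f"
    proof -
      obtain U U' where "\<And>b g. int (Suc (Suc j)) * g + int (Suc j) * b < U \<Longrightarrow> f b g = 0"
        "\<And>b g. int (Suc (Suc j)) * g + int (Suc j) * b < U' \<Longrightarrow> f' b g = 0"
        using add.IH unfolding supported_def by metis
      then show ?thesis
        by (intro supportedI[of _ "min U U'"]) auto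
    qed
    ultimately show ?case
      using add.IH by (auto intro: transfer_span.add)
  qed
  then show ?thesis by (simp add: admissible_def)
qed

text \<open>
  The evaluation at \<open>Q_0 = 1\<close> followed by the extraction of the coefficient of \<open>Q_1\<close> to the \<open>-1\<close>.
\<close>

definition base_functional :: functional where
  "base_functional = (\<lambda>b g. if g = -1 then 1 else 0)"

lemma admissible_base:
  obtains S where "admissible 0 S" "base_functional \<in> S"
proof
  \<comment> \<open>With this factor, \<open>shift\<close> multiplies \<open>a g\<close> by
    v^(-g-1). The factor is 1 at g = -1, so \<open>base_functional\<close> has this form.\<close>
  let ?F = "\<lambda>(a :: int \<Rightarrow> laurent) b g. qpow (- ((g + 1) * b)) * a g"
  let ?S = "?F ` {a. (\<forall>g\<ge>0. a g = 0) \<and> (\<exists>U. \<forall>g<U. a g = 0)}"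
  have mem: "?F a \<in> ?S" if "\<And>g. g \<ge> 0 \<Longrightarrow> a g = 0" "\<And>g. g < U \<Longrightarrow> a g = 0" for a U
    using that by blast
  have "shift f \<in> ?S \<and> ham f \<in> ?S \<and> supported 0 f \<and> (\<forall>b g. b \<ge> 0 \<longrightarrow> g \<ge> 0 \<longrightarrow> f b g = 0)"
    if "f \<in> ?S" for f
  proof -
    from that obtain a U where f: "f = ?F a" and a: "\<And>g. g \<ge> 0 \<Longrightarrow> a g = 0"
      and U: "\<And>g. g < U \<Longrightarrow> a g = 0"
      by auto
    have "shift f = ?F (\<lambda>g. qpow (- g - 1) * a g)"
      unfolding f shift_def mult.assoc[symmetric] qpow_add[symmetric]
      by (simp add: algebra_simps)
    then have "shift f \<in> ?S"
      by (simp only:) (rule mem[of _ U], auto simp: a U)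
    moreover have "ham f = ?F (\<lambda>g. qpow (g + 2) * a (g + 1) + (qpow (- g) - qpow g) * a (g - 1))"
      unfolding f ham_def right_diff_distrib left_diff_distrib distrib_left mult.assoc[symmetric]
        qpow_add[symmetric]
      by (intro ext) (simp add: algebra_simps)
    moreover have "?F (\<lambda>g. qpow (g + 2) * a (g + 1) + (qpow (- g) - qpow g) * a (g - 1)) \<in> ?S"
    proof (rule mem[of _ "U - 1"])
      \<comment> \<open>At g = 0 the possibly nonzero value \<open>a (-1)\<close> has coefficient
        v^0 - v^0 = 0.\<close>
      show "qpow (g + 2) * a (g + 1) + (qpow (- g) - qpow g) * a (g - 1) = 0" if "g \<ge> 0" for g
        using that by (cases "g = 0") (auto simp: a)
    qed (simp add: U)
    moreover have "supported 0 f"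
      by (rule supportedI[of _ U]) (auto simp: f U)
    ultimately show ?thesis
      using a by (simp add: f)
  qed
  then show "admissible 0 ?S" by (simp only: admissible_def) blast
  show "base_functional \<in> ?S"
    by (intro image_eqI[of _ _ "\<lambda>g. if g = -1 then 1 else 0"])
      (auto simp: base_functional_def fun_eq_iff intro!: exI[of _ "-1"])
qed

text \<open>
  Nested form of the fermionic sums.  The summation variable of \<open>transfer\<close> at level \<open>i\<close> is \<open>m_i\<close>,
  and its argument \<open>g\<close> is \<open>- q_i - 1\<close>; the predicate \<open>\<chi>\<close> restricts the \<open>q_i\<close> that occur.
\<close>

fun nested :: "(int \<Rightarrow> bool) \<Rightarrow> (nat \<Rightarrow> nat) \<Rightarrow> nat \<Rightarrow> functional" where
  "nested \<chi> n 0 = base_functional"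
| "nested \<chi> n (Suc j) =
    (shift ^^ n (Suc j)) (transfer (\<lambda>b g. if \<chi> (- g - 1) then nested \<chi> n j b g else 0))"

lemma nested_vanishes:
  assumes "b \<ge> 0" "g \<ge> 0"
  shows "nested (\<lambda>_. True) n j b g = 0"
proof -
  have "\<exists>S. admissible j S \<and> nested (\<lambda>_. True) n j \<in> S"
  proof (induction j)
    case 0
    show ?case using admissible_base by (metis nested.simps(1))
  next
    case (Suc j)
    then show ?case
      by (auto intro: admissible_transfer_span transfer_span.gen)
  qed
  then show ?thesis using assms by (auto simp: admissible_def)
qed

text \<open>For g < 0 the inner exponent - g is positive. Then \<open>nested_vanishes\<close> kills
  the inner value if g' \<ge> 0, that is q_j < 0, and the induction hypothesis applies if g' <
  0.\<close>

theorem nested_unrestricted_eq_restricted: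
  assumes "b \<ge> 0" "g < 0"
  shows "nested (\<lambda>_. True) n j b g = nested (\<lambda>c. c \<ge> 0) n j b g"
  using assms
proof (induction j arbitrary: b g)
  case (Suc j)
  have "nested (\<lambda>_. True) n j (- g) g' =
      (if 0 \<le> - g' - 1 then nested (\<lambda>c. c \<ge> 0) n j (- g) g' else 0)" for g'
    using Suc.IH[of "- g" g'] nested_vanishes[of "- g" g'] Suc.prems by auto
  then show ?case by (simp add: funpow_shift transfer_def)
qed simp

subsection \<open>Unfolding the nested sums\<close>

text \<open>
  With \<open>b = q_(j+1) + 1\<close> and \<open>g = - q_j - 1\<close>, the value \<open>- q_i - 1\<close> for \<open>i \<le> j\<close>.
\<close>

definition path :: "(nat \<Rightarrow> nat) \<Rightarrow> (nat \<Rightarrow> nat) \<Rightarrow> nat \<Rightarrow> int \<Rightarrow> int \<Rightarrow> nat \<Rightarrow> int" where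
  "path n m j b g i = g + int (j - i) * (g + b) +
    (\<Sum>l\<in>{1..j}. int (l - i) * (int (n l) - 2 * int (m l)))"

lemma path_top [simp]: "path n m j b g j = g"
  by (simp add: path_def)

lemma path_Suc:
  assumes "i \<le> j"
  shows "path n m (Suc j) b g i =
    path n m j (- g) (b + int (n (Suc j)) + 2 * g - 2 * int (m (Suc j))) i"
  using assms by (simp add: path_def algebra_simps of_nat_diff Suc_diff_le)

lemma path_cong: "(\<And>l. l \<in> {1..j} \<Longrightarrow> m l = m' l) \<Longrightarrow> path n m j b g i = path n m' j b g i"
  unfolding path_def by (intro arg_cong2[of _ _ _ _ "(+)"] sum.cong) auto

text \<open>The condition at 0 comes from \<open>base_functional\<close>; \<chi> is imposed below j
  only, as the value at j is the given g.\<close>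

definition path_index :: "(int \<Rightarrow> bool) \<Rightarrow> (nat \<Rightarrow> nat) \<Rightarrow> nat \<Rightarrow> int \<Rightarrow> int \<Rightarrow> (nat \<Rightarrow> nat) set" where
  "path_index \<chi> n j b g = {m \<in> {1..j} \<rightarrow>\<^sub>E UNIV.
    path n m j b g 0 = -1 \<and> (\<forall>i<j. \<chi> (- path n m j b g i - 1))}"

definition path_term :: "(nat \<Rightarrow> nat) \<Rightarrow> nat \<Rightarrow> int \<Rightarrow> int \<Rightarrow> (nat \<Rightarrow> nat) \<Rightarrow> laurent" where
  "path_term n j b g m =
    qpow (\<Sum>i\<in>{1..j}. path n m j b g i * (path n m j b g i - path n m j b g (i - 1))) *
    (\<Prod>i\<in>{1..j}. double_q (qbinom (m i) (- path n m j b g i - 1)))"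

text \<open>The condition at 0 fixes the sum of the l * m_l.\<close>

lemma finite_path_index: "finite (path_index \<chi> n j b g)"
proof (rule finite_subset)
  let ?B = "nat (g + int j * (g + b) + (\<Sum>l\<in>{1..j}. int l * int (n l)) + 1)"
  show "path_index \<chi> n j b g \<subseteq> {1..j} \<rightarrow>\<^sub>E {..?B}"
  proof
    fix m assume m: "m \<in> path_index \<chi> n j b g"
    then have "g + int j * (g + b) + (\<Sum>l\<in>{1..j}. int l * (int (n l) - 2 * int (m l))) = -1"
      by (auto simp: path_index_def path_def)
    then have s: "2 * (\<Sum>l\<in>{1..j}. int l * int (m l)) =
        g + int j * (g + b) + (\<Sum>l\<in>{1..j}. int l * int (n l)) + 1"
      by (simp add: right_diff_distrib sum_subtractf sum_distrib_left mult.left_commute)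
    have "m i \<le> ?B" if i: "i \<in> {1..j}" for i
    proof -
      have "int (m i) \<le> int i * int (m i)"
        using i by (cases "m i") (auto simp: mult_le_cancel_right1)
      also have "\<dots> \<le> (\<Sum>l\<in>{1..j}. int l * int (m l))"
        by (rule member_le_sum[OF i]) auto
      also have "\<dots> \<le> 2 * (\<Sum>l\<in>{1..j}. int l * int (m l))"
        using sum_nonneg[of "{1..j}" "\<lambda>l. int l * int (m l)"] by simp
      finally show ?thesis unfolding s by linarith
    qed
    then show "m \<in> {1..j} \<rightarrow>\<^sub>E {..?B}"
      using m by (auto simp: path_index_def PiE_iff)
  qed
  show "finite ({1..j} \<rightarrow>\<^sub>E {..?B})"
    by (intro finite_PiE) auto
qed

lemma sum_fibres:
  assumes "finite A"
  shows "(\<Sum>a\<in>A. f a) = Sum_any (\<lambda>x. \<Sum>a\<in>{a \<in> A. h a = x}. f a)"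
proof -
  have "Sum_any (\<lambda>x. \<Sum>a\<in>{a \<in> A. h a = x}. f a) = (\<Sum>x\<in>h ` A. \<Sum>a\<in>{a \<in> A. h a = x}. f a)"
  proof (rule Sum_any.expand_superset)
    show "{x. (\<Sum>a\<in>{a \<in> A. h a = x}. f a) \<noteq> 0} \<subseteq> h ` A"
    proof
      fix x assume "x \<in> {x. (\<Sum>a\<in>{a \<in> A. h a = x}. f a) \<noteq> 0}"
      then obtain a where "a \<in> {a \<in> A. h a = x}"
        by (auto elim: sum.not_neutral_contains_not_neutral)
      then show "x \<in> h ` A" by auto
    qed
  qed (use assms in simp)
  also have "\<dots> = sum f A"
    using assms by (simp add: sum.image_gen[of A f h])
  finally show ?thesis by simp
qed

lemma path_term_Suc:
  fixes b g :: int and n m :: "nat \<Rightarrow> nat" and j :: nat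
  defines "g' \<equiv> b + int (n (Suc j)) + 2 * g - 2 * int (m (Suc j))"
  shows "path_term n (Suc j) b g m = qpow (g * (g - g')) *
    double_q (qbinom (m (Suc j)) (- g - 1)) * path_term n j (- g) g' m"
proof -
  have p: "path n m (Suc j) b g i = path n m j (- g) g' i" if "i \<le> j" for i
    using path_Suc[OF that] by (simp add: g'_def)
  have "path n m (Suc j) b g j = g'"
    by (simp add: p)
  moreover have "(\<Sum>i\<in>{1..j}. path n m (Suc j) b g i *
        (path n m (Suc j) b g i - path n m (Suc j) b g (i - 1))) =
      (\<Sum>i\<in>{1..j}. path n m j (- g) g' i * (path n m j (- g) g' i - path n m j (- g) g' (i - 1)))"
    by (rule sum.cong) (auto simp: p)
  moreover have "(\<Prod>i\<in>{1..j}. double_q (qbinom (m i) (- path n m (Suc j) b g i - 1))) =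
      (\<Prod>i\<in>{1..j}. double_q (qbinom (m i) (- path n m j (- g) g' i - 1)))"
    by (rule prod.cong) (auto simp: p)
  ultimately show ?thesis
    by (simp add: path_term_def qpow_add mult_ac)
qed

lemma path_term_cong:
  assumes "\<And>l. l \<in> {1..j} \<Longrightarrow> m l = m' l"
  shows "path_term n j b g m = path_term n j b g m'"
proof -
  have "path n m j b g i = path n m' j b g i" for i
    using assms by (rule path_cong)
  then show ?thesis using assms by (simp add: path_term_def)
qed

lemma path_index_fibre:
  fixes b g :: int and n :: "nat \<Rightarrow> nat" and j x :: nat
  defines "g' \<equiv> b + int (n (Suc j)) + 2 * g - 2 * int x"
  shows "bij_betw (\<lambda>m. m(Suc j := x)) (if \<chi> (- g' - 1) then path_index \<chi> n j (- g) g' else {})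
    {m \<in> path_index \<chi> n (Suc j) b g. m (Suc j) = x}"
\<comment> \<open>The value \<open>undefined\<close> makes the restricted vector extensional on
  \<open>{1..j}\<close>.\<close>
proof (rule bij_betw_byWitness[of _ "\<lambda>m. m(Suc j := undefined)"])
  have p: "path n m (Suc j) b g i = path n m j (- g) g' i" if "i \<le> j" "m (Suc j) = x" for i m
    using path_Suc[OF that(1)] that(2) by (simp add: g'_def)
  have upd: "path n (m(Suc j := y)) j b g i = path n m j b g i" for m y b g i
    by (rule path_cong) auto
  show "\<forall>m\<in>if \<chi> (- g' - 1) then path_index \<chi> n j (- g) g' else {}.
      (m(Suc j := x))(Suc j := undefined) = m"
    by (auto simp: path_index_def fun_eq_iff PiE_iff extensional_def)
  show "\<forall>m\<in>{m \<in> path_index \<chi> n (Suc j) b g. m (Suc j) = x}.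
      (m(Suc j := undefined))(Suc j := x) = m"
    by auto
  show "(\<lambda>m. m(Suc j := x)) ` (if \<chi> (- g' - 1) then path_index \<chi> n j (- g) g' else {})
      \<subseteq> {m \<in> path_index \<chi> n (Suc j) b g. m (Suc j) = x}"
    by (auto simp: path_index_def PiE_iff extensional_def p upd less_Suc_eq split: if_splits)
  show "(\<lambda>m. m(Suc j := undefined)) ` {m \<in> path_index \<chi> n (Suc j) b g. m (Suc j) = x}
      \<subseteq> (if \<chi> (- g' - 1) then path_index \<chi> n j (- g) g' else {})"
    by (auto simp: path_index_def PiE_iff extensional_def p upd less_Suc_eq)
qed

lemma nested_eq_sum: "nested \<chi> n j b g = (\<Sum>m\<in>path_index \<chi> n j b g. path_term n j b g m)"
proof (induction j arbitrary: b g)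
  case 0
  have "path_index \<chi> n 0 b g = (if g = -1 then {\<lambda>_. undefined} else {})"
    by (auto simp: path_index_def path_def)
  then show ?case by (simp add: base_functional_def path_term_def)
next
  case (Suc j)
  let ?g = "\<lambda>x. b + int (n (Suc j)) + 2 * g - 2 * int x"
  have *: "(\<Sum>m\<in>{m \<in> path_index \<chi> n (Suc j) b g. m (Suc j) = x}. path_term n (Suc j) b g m) =
      qpow (- (g * (g + (b + int (n (Suc j)))))) *
      (poch x g * (if \<chi> (- ?g x - 1) then nested \<chi> n j (- g) (?g x) else 0))" for x
  proof -
    let ?I = "if \<chi> (- ?g x - 1) then path_index \<chi> n j (- g) (?g x) else {}"
    have "(\<Sum>m\<in>{m \<in> path_index \<chi> n (Suc j) b g. m (Suc j) = x}. path_term n (Suc j) b g m) =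
        (\<Sum>m\<in>?I. path_term n (Suc j) b g (m(Suc j := x)))"
      by (rule sum.reindex_bij_betw[OF path_index_fibre, symmetric])
    also have "\<dots> = (\<Sum>m\<in>?I. qpow (g * (g - ?g x)) * double_q (qbinom x (- g - 1)) *
        path_term n j (- g) (?g x) m)"
      by (intro sum.cong refl) (auto simp: path_term_Suc intro!: path_term_cong)
    also have "\<dots> = qpow (g * (g - ?g x)) * double_q (qbinom x (- g - 1)) *
        (if \<chi> (- ?g x - 1) then nested \<chi> n j (- g) (?g x) else 0)"
      by (simp add: Suc.IH sum_distrib_left)
    \<comment> \<open>The part of the exponent linear in x belongs to \<open>poch x g\<close>, the
      rest is the prefactor of \<open>transfer\<close>.\<close>
    also have "qpow (g * (g - ?g x)) =
        qpow (- (g * (g + (b + int (n (Suc j)))))) * qpow (2 * g * int x)"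
      unfolding qpow_add[symmetric] by (simp add: algebra_simps)
    finally show ?thesis by (simp add: poch_def mult.assoc)
  qed
  have fin: "finite {x. (\<Sum>m\<in>{m \<in> path_index \<chi> n (Suc j) b g. m (Suc j) = x}.
      path_term n (Suc j) b g m) \<noteq> 0}"
  proof (rule finite_subset)
    show "finite ((\<lambda>m. m (Suc j)) ` path_index \<chi> n (Suc j) b g)"
      by (simp add: finite_path_index)
  qed (auto elim: sum.not_neutral_contains_not_neutral)
  \<comment> \<open>Finite support allows the prefactor to be pulled out of
    \<open>Sum_any\<close>.\<close>
  have fin': "finite {x. poch x g * (if \<chi> (- ?g x - 1) then nested \<chi> n j (- g) (?g x) else 0) \<noteq> 0}"
    (is "finite {x. ?h x \<noteq> 0}")
  proof (rule finite_subset[OF _ fin], safe)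
    fix x assume h: "?h x \<noteq> 0"
      and "(\<Sum>m\<in>{m \<in> path_index \<chi> n (Suc j) b g. m (Suc j) = x}. path_term n (Suc j) b g m) = 0"
    then have "qpow (- (g * (g + (b + int (n (Suc j)))))) * ?h x = 0"
      by (simp only: *)
    with h show False by (simp only: mult_eq_0_iff qpow_neq_0 simp_thms)
  qed
  have "(\<Sum>m\<in>path_index \<chi> n (Suc j) b g. path_term n (Suc j) b g m) =
      qpow (- (g * (g + (b + int (n (Suc j)))))) * Sum_any ?h"
    unfolding sum_fibres[OF finite_path_index, of "path_term n (Suc j) b g" \<chi> n "Suc j" b g
        "\<lambda>m. m (Suc j)"] *
    by (rule Sum_any_right_distrib[OF fin', symmetric])
  then show ?case
    by (simp only: nested.simps funpow_shift transfer_def poch_sum_def)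
qed

subsection \<open>The quadratic form\<close>

lemma p_vec_diff:
  assumes "i \<ge> 1"
  shows "p_vec k m n i - p_vec k m n (i - 1) =
    (\<Sum>a\<in>{1..k}. of_bool (i \<le> a) * (int (n a) - 2 * int (m a)))"
  unfolding p_vec_def A_entry_def sum_subtractf[symmetric] left_diff_distrib[symmetric]
  by (rule sum.cong) (use assms in \<open>auto simp: min_def of_nat_diff\<close>)

text \<open>A is the Gram matrix of the vectors with entries [i \<le> a], so the left side is x^t A
  x for x = n - 2 m.\<close>

lemma sum_square_p_vec_diff:
  "(\<Sum>i\<in>{1..k}. (p_vec k m n i - p_vec k m n (i - 1))\<^sup>2) =
    4 * Q_form k m n + (\<Sum>a\<in>{1..k}. \<Sum>b\<in>{1..k}. A_entry a b * int (n a) * int (n b))"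
proof -
  define x where "x = (\<lambda>a. int (n a) - 2 * int (m a))"
  have min: "(\<Sum>i\<in>{1..k}. of_bool (i \<le> a) * of_bool (i \<le> b)) = A_entry a b"
    if "a \<in> {1..k}" for a b
  proof -
    have "(\<Sum>i\<in>{1..k}. of_bool (i \<le> a) * of_bool (i \<le> b)) = (\<Sum>i\<in>{1..min a b}. 1 :: int)"
      using that by (intro sum.mono_neutral_cong_right) auto
    then show ?thesis by (simp add: A_entry_def)
  qed
  have "(\<Sum>i\<in>{1..k}. (p_vec k m n i - p_vec k m n (i - 1))\<^sup>2) =
      (\<Sum>i\<in>{1..k}. \<Sum>a\<in>{1..k}. \<Sum>b\<in>{1..k}. of_bool (i \<le> a) * of_bool (i \<le> b) * (x a * x b))"
  proof (rule sum.cong[OF refl])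
    fix i assume "i \<in> {1..k}"
    then have "i \<ge> 1" by simp
    show "(p_vec k m n i - p_vec k m n (i - 1))\<^sup>2 =
        (\<Sum>a\<in>{1..k}. \<Sum>b\<in>{1..k}. of_bool (i \<le> a) * of_bool (i \<le> b) * (x a * x b))"
      unfolding p_vec_diff[OF \<open>i \<ge> 1\<close>] power2_eq_square sum_product x_def
      by (intro sum.cong refl) (simp only: mult_ac)
  qed
  also have "\<dots> = (\<Sum>a\<in>{1..k}. \<Sum>i\<in>{1..k}. \<Sum>b\<in>{1..k}.
      of_bool (i \<le> a) * of_bool (i \<le> b) * (x a * x b))"
    by (rule sum.swap)
  also have "\<dots> = (\<Sum>a\<in>{1..k}. \<Sum>b\<in>{1..k}. \<Sum>i\<in>{1..k}.
      of_bool (i \<le> a) * of_bool (i \<le> b) * (x a * x b))"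
    by (rule sum.cong[OF refl], rule sum.swap)
  also have "\<dots> = (\<Sum>a\<in>{1..k}. \<Sum>b\<in>{1..k}. A_entry a b * (x a * x b))"
    by (intro sum.cong refl) (simp only: min flip: sum_distrib_right)
  also have "\<dots> = 4 * Q_form k m n
      + (\<Sum>a\<in>{1..k}. \<Sum>b\<in>{1..k}. A_entry a b * int (n a) * int (n b))
      + 2 * ((\<Sum>a\<in>{1..k}. \<Sum>b\<in>{1..k}. A_entry a b * int (m a) * int (n b))
      - (\<Sum>a\<in>{1..k}. \<Sum>b\<in>{1..k}. A_entry a b * int (n a) * int (m b)))"
    unfolding Q_form_def x_def sum_distrib_left sum_subtractf[symmetric] sum.distrib[symmetric]
    by (intro sum.cong refl) (simp add: algebra_simps)
  \<comment> \<open>By symmetry of A the cross terms cancel.\<close>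
  also have "(\<Sum>a\<in>{1..k}. \<Sum>b\<in>{1..k}. A_entry a b * int (n a) * int (m b)) =
      (\<Sum>a\<in>{1..k}. \<Sum>b\<in>{1..k}. A_entry a b * int (m a) * int (n b))"
    by (subst sum.swap) (simp add: A_entry_def min.commute mult_ac)
  finally show ?thesis by simp
qed

text \<open>2 x (x - y) = (x - y)^2 + x^2 - y^2, and the last two squares telescope.\<close>

lemma sum_telescope_square:
  fixes p :: "nat \<Rightarrow> int"
  assumes "p 0 = 0"
  shows "2 * (\<Sum>i\<in>{1..k}. (p i + 1) * (p i - p (i - 1))) =
    (\<Sum>i\<in>{1..k}. (p i - p (i - 1))\<^sup>2) + (p k)\<^sup>2 + 2 * p k"
  by (induction k) (auto simp: assms power2_eq_square algebra_simps)

section \<open>Paths, terms and index sets in the notation of the fermionic sums\<close>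

lemma p_vec_0 [simp]: "p_vec k m n 0 = 0"
  by (simp add: p_vec_def A_entry_def)

lemma p_vec_top: "p_vec k m n k = l - q_zero k l m n"
proof -
  have "p_vec k m n k = (\<Sum>i\<in>{1..k}. int i * (int (n i) - 2 * int (m i)))"
    unfolding p_vec_def A_entry_def by (rule sum.cong) auto
  also have "\<dots> = - (\<Sum>i\<in>{1..k}. int i * (2 * int (m i) - int (n i)))"
    unfolding sum_negf[symmetric] by (rule sum.cong) (auto simp: algebra_simps)
  finally show ?thesis by (simp add: q_zero_def)
qed

text \<open>Here b + g = 0, and truncated subtraction gives (a - i) + min(a, i) = a; the path is -
  q_i - 1 with q_i = q_0 + p_i.\<close>

lemma path_eq:
  assumes "i \<le> k"
  shows "path n m k (l + 1) (- l - 1) i = - p_vec k m n i - 1 - q_zero k l m n"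
proof -
  have "path n m k (l + 1) (- l - 1) i + p_vec k m n i + 1 + q_zero k l m n =
      (\<Sum>a\<in>{1..k}. int (a - i) * (int (n a) - 2 * int (m a)) +
        A_entry a i * (int (n a) - 2 * int (m a)) + int a * (2 * int (m a) - int (n a)))"
    by (simp add: path_def p_vec_def q_zero_def sum.distrib)
  also have "\<dots> = 0"
  proof (rule sum.neutral, rule ballI)
    fix a
    have "int (a - i) + A_entry a i = int a"
      by (simp add: A_entry_def)
    then have "int (a - i) * (int (n a) - 2 * int (m a)) +
        A_entry a i * (int (n a) - 2 * int (m a)) = int a * (int (n a) - 2 * int (m a))"
      by (metis distrib_right)
    then show "int (a - i) * (int (n a) - 2 * int (m a)) +
        A_entry a i * (int (n a) - 2 * int (m a)) + int a * (2 * int (m a) - int (n a)) = 0"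
      by (simp add: algebra_simps)
  qed
  finally show ?thesis by simp
qed

lemma path_term_eq:
  obtains K where "\<And>m. q_zero k l m n = 0 \<Longrightarrow>
    path_term n k (l + 1) (- l - 1) m = qpow K * double_q (fermionic_term k m n)"
proof
  fix m assume q: "q_zero k l m n = 0"
  let ?N = "\<Sum>a\<in>{1..k}. \<Sum>b\<in>{1..k}. A_entry a b * int (n a) * int (n b)"
  \<comment> \<open>This is independent of m. The division is exact, as 2 \<open>?X\<close> turns
    out to be 4 Q plus the numerator.\<close>
  let ?K = "(?N + l\<^sup>2 + 2 * l) div 2"
  let ?p = "path n m k (l + 1) (- l - 1)"
  let ?X = "\<Sum>i\<in>{1..k}. ?p i * (?p i - ?p (i - 1))"
  have "?X = (\<Sum>i\<in>{1..k}. (p_vec k m n i + 1) * (p_vec k m n i - p_vec k m n (i - 1)))"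
  proof (rule sum.cong[OF refl])
    fix i assume "i \<in> {1..k}"
    then have "?p i = - p_vec k m n i - 1" "?p (i - 1) = - p_vec k m n (i - 1) - 1"
      using path_eq[of _ k n m l] q by auto
    then show "?p i * (?p i - ?p (i - 1)) = (p_vec k m n i + 1) * (p_vec k m n i - p_vec k m n (i - 1))"
      by (simp only:) (simp add: algebra_simps)
  qed
  then have "2 * ?X = 4 * Q_form k m n + (?N + l\<^sup>2 + 2 * l)"
    using sum_telescope_square[of "p_vec k m n" k, OF p_vec_0] sum_square_p_vec_diff[of k m n]
    by (simp only: p_vec_top[of k m n l] q) simp
  then have X: "?X = ?K + 2 * Q_form k m n"
    by linarith
  have "(\<Prod>i\<in>{1..k}. double_q (qbinom (m i) (- ?p i - 1))) =
      (\<Prod>i\<in>{1..k}. double_q (qbinom (m i) (p_vec k m n i)))"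
    by (rule prod.cong) (auto simp: path_eq q)
  then show "path_term n k (l + 1) (- l - 1) m = qpow ?K * double_q (fermionic_term k m n)"
    unfolding path_term_def fermionic_term_def X
    by (simp add: qpow_add double_q_mult double_q_prod mult.assoc)
qed

lemma path_index_N: "path_index (\<lambda>_. True) n k (l + 1) (- l - 1) = N_index k l n"
  by (auto simp: path_index_def N_index_def path_eq)

text \<open>When q_0 = 0, the two ranges of i impose the same conditions because p_0 = 0 and p_k = l
  \<ge> 0.\<close>

lemma path_index_M:
  assumes "l \<ge> 0"
  shows "path_index (\<lambda>c. c \<ge> 0) n k (l + 1) (- l - 1) = M_index k l n"
proof -
  have "(\<forall>i<k. 0 \<le> - path n m k (l + 1) (- l - 1) i - 1) \<longleftrightarrow> (\<forall>i\<in>{1..k}. p_vec k m n i \<ge> 0)"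
    if q: "q_zero k l m n = 0" for m
  proof -
    have "(\<forall>i<k. 0 \<le> - path n m k (l + 1) (- l - 1) i - 1) \<longleftrightarrow> (\<forall>i<k. p_vec k m n i \<ge> 0)"
      by (simp add: path_eq q)
    moreover have "p_vec k m n 0 \<ge> 0" "p_vec k m n k \<ge> 0"
      using assms q by (simp_all add: p_vec_top[of k m n l])
    ultimately show ?thesis
      by (metis One_nat_def Suc_leI atLeastAtMost_iff gr0I le_neq_implies_less less_imp_le_nat)
  qed
  then have "path n m k (l + 1) (- l - 1) 0 = -1 \<and>
        (\<forall>i<k. 0 \<le> - path n m k (l + 1) (- l - 1) i - 1) \<longleftrightarrow>
      q_zero k l m n = 0 \<and> (\<forall>i\<in>{1..k}. p_vec k m n i \<ge> 0)" for m
    using path_eq[of 0 k n m l] by auto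
  then show ?thesis
    by (simp only: path_index_def M_index_def)
qed

theorem theorem4p1:
  fixes l :: int and k :: nat and n :: "nat \<Rightarrow> nat"
  assumes "l \<ge> 0" and "k \<ge> 1"
  shows "N_poly k l n = M_poly k l n"
proof -
  obtain K where K: "\<And>m. q_zero k l m n = 0 \<Longrightarrow>
      path_term n k (l + 1) (- l - 1) m = qpow K * double_q (fermionic_term k m n)"
    using path_term_eq by metis
  have N: "nested (\<lambda>_. True) n k (l + 1) (- l - 1) = qpow K * double_q (N_sum k l n)"
    unfolding nested_eq_sum path_index_N N_sum_def double_q_sum sum_distrib_left
    by (rule sum.cong) (auto simp: N_index_def K)
  have M: "nested (\<lambda>c. c \<ge> 0) n k (l + 1) (- l - 1) = qpow K * double_q (M_sum k l n)"
    unfolding nested_eq_sum path_index_M[OF assms(1)] M_sum_def double_q_sum sum_distrib_left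
    by (rule sum.cong) (auto simp: M_index_def K)
  \<comment> \<open>The arguments encode q_(k+1) = q_k = l, so l \<ge> 0 gives the required
    signs.\<close>
  have "qpow K * double_q (N_sum k l n) = qpow K * double_q (M_sum k l n)"
    unfolding N[symmetric] M[symmetric]
    by (rule nested_unrestricted_eq_restricted) (use assms(1) in auto)
  then have "double_q (N_sum k l n) = double_q (M_sum k l n)"
    by simp
  then have "N_sum k l n = M_sum k l n"
    using inj_double_q by (simp add: inj_eq)
  then show ?thesis by (simp add: N_poly_def M_poly_def)
qed

end
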